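(* Let $(\tau_n)_{n\ge 0}$ be the random recursive tree with doubling events at the root. For all integers $i,n\ge 0$, let $U_i(n)$ be the number of nodes in $\tau_n$ that have exactly $i$ children. Then, for every $i\ge0$, almost surely as $n\to\infty$, $$\frac{U_i(n)}{|\tau_n|}\to\frac1{2^{i+1}}.$$
   Context: Trees (Ulam--Harris notation): a tree is a set $\tau$ of finite words over the alphabet $\{1,2,3,\ldots\}$ such that every prefix of a word of $\tau$ (including the empty word $\varnothing$, called the root) is in $\tau$. Elements of $\tau$ are called nodes; $|\tau|$ is the number of nodes. The children of a node $w\in\tau$ are the nodes of $\tau$ of the form $wj$ with $j\in\{1,2,\ldots\}$. The random recursive tree with doubling events $(\tau_n)_{n\ge0}$ is defined by $\tau_0=\{\varnothing\}$ and, for all $n\ge0$, given $\tau_n$ (and the past): pick a node $\nu_n$ uniformly at random among the nodes of $\tau_n$; - if $\nu_n=\varnothing$, set $\tau_{n+1}=\{\varnothing\}\cup\{1w: w\in\tau_n\}\cup\{2w: w\in\tau_n\}$ (a doubling event); - if $\nu_n\ne\varnothing$, set $\tau_{n+1}=\tau_n\cup\{\nu_n j\}$ where $j=\min\{i\ge1:\nu_n i\notin\tau_n\}$. *)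

theory Defs
  imports "HOL-Probability.Probability"
begin

text \<open>
  Words are lists of naturals, the root is the empty list. The alphabet is \<open>{1, 2, 3, \<dots>}\<close>, so
  the letter \<open>0\<close> is excluded explicitly wherever a letter is chosen.
\<close>

type_synonym word = "nat list"

definition children :: "word set \<Rightarrow> word \<Rightarrow> word set" where
  "children t w = {w @ [j] | j. 1 \<le> j \<and> w @ [j] \<in> t}"

definition doubling :: "word set \<Rightarrow> word set" where
  "doubling t = {[]} \<union> {1 # w | w. w \<in> t} \<union> {2 # w | w. w \<in> t}"

definition add_child :: "word set \<Rightarrow> word \<Rightarrow> word set" where
  "add_child t v = t \<union> {v @ [LEAST j. 1 \<le> j \<and> v @ [j] \<notin> t]}"

definition next_tree :: "word set \<Rightarrow> word \<Rightarrow> word set" where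
  "next_tree t v = (if v = [] then doubling t else add_child t v)"

text \<open>
  The tree is a deterministic function of the previously picked nodes, hence discrete. Conditioning
  on the past at time \<open>n\<close> can therefore be stated elementarily, through the events of positive
  probability that prescribe the trees up to time \<open>n\<close> and the nodes picked before time \<open>n\<close>.
\<close>

locale recursive_tree_doubling = prob_space M
  for M :: "'a measure" +
  fixes \<nu> :: "nat \<Rightarrow> 'a \<Rightarrow> word"
    and \<tau> :: "nat \<Rightarrow> 'a \<Rightarrow> word set"
  assumes measurable_pick: "\<nu> n \<in> measurable M (count_space UNIV)"
    and tree_0: "\<omega> \<in> space M \<Longrightarrow> \<tau> 0 \<omega> = {[]}"
    and tree_Suc: "\<omega> \<in> space M \<Longrightarrow> \<tau> (Suc n) \<omega> = next_tree (\<tau> n \<omega>) (\<nu> n \<omega>)"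
    and uniform_pick:
      "\<P>(\<omega> in M. (\<forall>k\<le>n. \<tau> k \<omega> = t k) \<and> (\<forall>k<n. \<nu> k \<omega> = w k)) > 0 \<Longrightarrow>
       \<P>(\<omega> in M. \<nu> n \<omega> = v \<bar> (\<forall>k\<le>n. \<tau> k \<omega> = t k) \<and> (\<forall>k<n. \<nu> k \<omega> = w k))
         = pmf (pmf_of_set (t n)) v"

definition num_nodes_with_children :: "nat \<Rightarrow> word set \<Rightarrow> nat" where
  "num_nodes_with_children i t = card {w \<in> t. card (children t w) = i}"

end

theory Submission
  imports Defs "HOL-Real_Asymp.Real_Asymp"
begin

text \<open>
  Let \<open>D\<^sub>j = U\<^sub>j - N / 2\<^sup>j\<^sup>+\<^sup>1\<close> with \<open>N\<close> the number of nodes. A doubling event doubles \<open>D\<^sub>j\<close> up to \<open>O(1)\<close>, and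
  otherwise the mean increment of \<open>D\<^sub>j\<close> is \<open>(D\<^bsub>j-1\<^esub> - D\<^sub>j) / N\<close>. In the conditional drift of
  \<open>D\<^sub>j\<^sup>2 / N\<close> the contribution of the doublings is compensated, and the drift is at most
  \<open>(D\<^bsub>j-1\<^esub>\<^sup>2 - D\<^sub>j\<^sup>2) / N\<^sup>2 + O(1/N)\<close>, which telescopes over \<open>j \<le> i\<close>. As \<open>N > n\<close> at time \<open>n\<close>, the
  mean of \<open>(U\<^sub>i / N - 1 / 2\<^sup>i\<^sup>+\<^sup>1)\<^sup>2\<close> is \<open>O(1/\<surd>n)\<close>, hence summable along the fourth powers, which gives
  almost sure convergence along them. The gaps are filled deterministically, because one step
  changes \<open>U\<^sub>i / N\<close> by at most \<open>2 / N\<close>.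
\<close>

section \<open>One step of the tree\<close>

definition is_tree :: "word set \<Rightarrow> bool" where
  "is_tree t \<longleftrightarrow> finite t \<and> [] \<in> t \<and> (\<forall>w j. w @ [j] \<in> t \<longrightarrow> w \<in> t)"

lemma is_treeD:
  assumes "is_tree t"
  shows "finite t" "[] \<in> t" "w @ [j] \<in> t \<Longrightarrow> w \<in> t" "t \<noteq> {}" "card t > 0"
  using assms unfolding is_tree_def by (auto simp: card_gt_0_iff)

lemma finite_children: "finite t \<Longrightarrow> finite (children t w)"
  by (rule finite_subset[of _ t]) (auto simp: children_def)

lemma is_tree_root: "is_tree {[]}"
  by (simp add: is_tree_def)

lemma doubling_altdef: "doubling t = insert [] ((#) 1 ` t \<union> (#) 2 ` t)"
  unfolding doubling_def by auto

section \<open>Effect of a doubling event\<close>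

lemma is_tree_doubling:
  assumes "is_tree t"
  shows "is_tree (doubling t)"
  unfolding is_tree_def
proof (intro conjI allI impI)
  show "finite (doubling t)" "[] \<in> doubling t"
    using is_treeD(1)[OF assms] by (simp_all add: doubling_altdef)
  show "w \<in> doubling t" if "w @ [j] \<in> doubling t" for w j
    using that is_treeD(3)[OF assms] by (cases w) (auto simp: doubling_altdef)
qed

lemma card_doubling:
  assumes "is_tree t"
  shows "card (doubling t) = 2 * card t + 1"
proof -
  have "card ((#) (1::nat) ` t \<union> (#) 2 ` t) = card t + card t"
    using is_treeD(1)[OF assms] by (subst card_Un_disjoint) (auto simp: card_image)
  then show ?thesis
    unfolding doubling_altdef using is_treeD(1)[OF assms] by (subst card_insert_disjoint) auto
qed

lemma children_doubling_root:
  assumes "is_tree t"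
  shows "children (doubling t) [] = {[1], [2]}"
  using is_treeD(2)[OF assms] unfolding children_def doubling_altdef by auto

lemma children_doubling_Cons:
  assumes "a = 1 \<or> a = 2"
  shows "children (doubling t) (a # w) = (#) a ` children t w"
  using assms unfolding children_def doubling_altdef by auto

text \<open>Both copies of \<open>t\<close> hang below the new root as complete subtrees, so their
  nodes keep their numbers of children. The correction term is the new root, which has exactly two
  children.\<close>

lemma num_nodes_doubling:
  assumes t: "is_tree t"
  shows "num_nodes_with_children i (doubling t) = 2 * num_nodes_with_children i t + of_bool (i = 2)"
proof -
  define S where "S = {w \<in> t. card (children t w) = i}"
  have fin: "finite S"
    using is_treeD(1)[OF t] by (simp add: S_def)
  have r: "card (children (doubling t) []) = 2"
    by (subst children_doubling_root[OF t]) simp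
  have c: "card (children (doubling t) (a # w)) = card (children t w)" if "a = 1 \<or> a = 2" for a w
    using that by (simp add: children_doubling_Cons card_image)
  have "{w \<in> doubling t. card (children (doubling t) w) = i}
      = (if i = 2 then {[]} else {}) \<union> ((#) 1 ` S \<union> (#) 2 ` S)" (is "_ = ?R")
  proof (intro set_eqI)
    fix w
    show "w \<in> {w \<in> doubling t. card (children (doubling t) w) = i} \<longleftrightarrow> w \<in> ?R"
    proof (cases w)
      case Nil
      then show ?thesis using r by (auto simp: doubling_altdef)
    next
      case (Cons a v)
      have "a # v \<in> doubling t \<longleftrightarrow> (a = 1 \<or> a = 2) \<and> v \<in> t"
        by (auto simp: doubling_altdef)
      moreover have "a # v \<in> ?R \<longleftrightarrow> (a = 1 \<or> a = 2) \<and> v \<in> S"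
        by (simp add: image_iff) blast
      moreover have "v \<in> S \<longleftrightarrow> v \<in> t \<and> card (children t v) = i"
        by (simp add: S_def)
      ultimately show ?thesis
        using c[of a v] unfolding Cons mem_Collect_eq by metis
    qed
  qed
  moreover have "card ((#) 1 ` S \<union> (#) (2::nat) ` S) = card S + card S"
    using fin by (subst card_Un_disjoint) (auto simp: card_image)
  ultimately show ?thesis
    unfolding num_nodes_with_children_def using fin by (auto simp: S_def card_insert_if)
qed

section \<open>Effect of attaching a leaf\<close>

text \<open>A finite tree leaves some positive letter free below \<open>v\<close>, so the
  \<open>LEAST\<close> in \<open>add_child\<close> is attained.\<close>

lemma add_child_fresh:
  assumes "is_tree t"
  obtains j where "add_child t v = insert (v @ [j]) t" "v @ [j] \<notin> t" "1 \<le> j"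
proof -
  have "finite ((\<lambda>j. v @ [j]) -` t)"
    using is_treeD(1)[OF assms] by (intro finite_vimageI) (auto simp: inj_def)
  then obtain j where "j \<notin> insert 0 ((\<lambda>j. v @ [j]) -` t)"
    by (metis ex_new_if_finite finite_insert infinite_UNIV_nat)
  then have ex: "1 \<le> j \<and> v @ [j] \<notin> t"
    by auto
  show thesis
    using that LeastI[of "\<lambda>j. 1 \<le> j \<and> v @ [j] \<notin> t", OF ex] by (auto simp: add_child_def)
qed

lemma is_tree_add_child:
  assumes "is_tree t" "v \<in> t"
  shows "is_tree (add_child t v)"
proof -
  obtain j where "add_child t v = insert (v @ [j]) t"
    using add_child_fresh[OF assms(1)] by metis
  then show ?thesis
    using assms unfolding is_tree_def by auto
qed

lemma card_add_child:
  assumes "is_tree t"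
  shows "card (add_child t v) = card t + 1"
proof -
  obtain j where "add_child t v = insert (v @ [j]) t" "v @ [j] \<notin> t"
    using add_child_fresh[OF assms] by metis
  then show ?thesis
    using is_treeD(1)[OF assms] by simp
qed

lemma real_num_nodes:
  assumes "finite t"
  shows "real (num_nodes_with_children i t) = (\<Sum>w\<in>t. of_bool (card (children t w) = i))"
  using assms unfolding num_nodes_with_children_def
  by (simp add: Int_def of_bool_def flip: sum.inter_filter)

text \<open>The new node is a leaf, \<open>v\<close> moves from its class to the next one, and every
  other node keeps its children.\<close>

lemma num_nodes_add_child:
  assumes t: "is_tree t" and v: "v \<in> t"
  shows "real (num_nodes_with_children i (add_child t v)) =
    real (num_nodes_with_children i t) + of_bool (i = 0)
      + of_bool (card (children t v) + 1 = i) - of_bool (card (children t v) = i)"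
proof -
  obtain j where s: "add_child t v = insert (v @ [j]) t" and new: "v @ [j] \<notin> t" and j: "1 \<le> j"
    using add_child_fresh[OF t] by metis
  let ?s = "add_child t v" and ?c = "\<lambda>w. card (children t w)"
  have fin: "finite t" "finite ?s"
    using is_treeD(1)[OF t] by (auto simp: s)
  \<comment> \<open>By prefix closure, a child of the new node lying in \<open>t\<close> would force
    \<open>v @ [j]\<close> into \<open>t\<close>.\<close>
  have "children ?s (v @ [j]) = {}"
    using new is_treeD(3)[OF t] unfolding children_def s by auto
  then have u: "card (children ?s (v @ [j])) = 0"
    by simp
  have "children ?s v = insert (v @ [j]) (children t v)"
    using j unfolding children_def s by auto
  moreover have "v @ [j] \<notin> children t v"
    using new unfolding children_def by auto
  ultimately have cv: "card (children ?s v) = ?c v + 1"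
    using finite_children[OF fin(1)] by simp
  have cw: "card (children ?s w) = ?c w" if "w \<noteq> v" for w
    using that unfolding children_def s by (metis append1_eq_conv insert_iff)
  have "real (num_nodes_with_children i ?s) = of_bool (i = 0)
      + (\<Sum>w\<in>t. of_bool (card (children ?s w) = i))"
    unfolding real_num_nodes[OF fin(2)] using u fin(1) new
    by (subst (1) s) (auto simp: of_bool_def)
  also have "(\<Sum>w\<in>t. of_bool (card (children ?s w) = i) :: real)
      = (\<Sum>w\<in>t. of_bool (?c w = i) +
          (if w = v then of_bool (?c v + 1 = i) - of_bool (?c v = i) else 0))"
    using cv cw by (intro sum.cong) auto
  also have "\<dots> = real (num_nodes_with_children i t) + (of_bool (?c v + 1 = i) - of_bool (?c v = i))"
    using fin(1) v by (simp add: sum.distrib real_num_nodes)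
  finally show ?thesis
    by simp
qed

section \<open>Common bounds for both kinds of step\<close>

lemma num_nodes_le_card: "finite t \<Longrightarrow> num_nodes_with_children i t \<le> card t"
  unfolding num_nodes_with_children_def by (intro card_mono) auto

lemma is_tree_next_tree: "is_tree t \<Longrightarrow> v \<in> t \<Longrightarrow> is_tree (next_tree t v)"
  by (simp add: next_tree_def is_tree_doubling is_tree_add_child)

lemma card_next_tree: "is_tree t \<Longrightarrow> card t + 1 \<le> card (next_tree t v)"
  by (simp add: next_tree_def card_doubling card_add_child)

definition proportion :: "nat \<Rightarrow> word set \<Rightarrow> real" where
  "proportion i t = real (num_nodes_with_children i t) / real (card t)"

text \<open>With a = 2 for a doubling and a = 1 for a new leaf, the new proportion is (a U + e) / (a
  N + 1) with |e| \<le> 1. Its difference to U / N is (e N - U) / ((a N + 1) N): multiplying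
  numerator and denominator by a has no effect on the ratio.\<close>

lemma proportion_next_tree:
  assumes t: "is_tree t" and v: "v \<in> t"
  shows "\<bar>proportion i (next_tree t v) - proportion i t\<bar> \<le> 2 / real (card t)"
proof -
  define N U where "N = real (card t)" and "U = real (num_nodes_with_children i t)"
  have N: "N > 0"
    using is_treeD(5)[OF t] by (simp add: N_def)
  have U: "0 \<le> U" "U \<le> N"
    using num_nodes_le_card[OF is_treeD(1)[OF t]] by (auto simp: U_def N_def)
  show ?thesis
  proof (cases "v = []")
    case True
    define e :: real where "e = of_bool (i = 2)"
    have e: "0 \<le> e" "e \<le> 1"
      by (auto simp: e_def)
    have "proportion i (next_tree t v) = (2 * U + e) / (2 * N + 1)"
      by (simp add: True next_tree_def proportion_def num_nodes_doubling[OF t] card_doubling[OF t]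
          U_def N_def e_def)
    then have "proportion i (next_tree t v) - proportion i t = (2 * U + e) / (2 * N + 1) - U / N"
      by (simp add: proportion_def[of i t] U_def N_def)
    then have "proportion i (next_tree t v) - proportion i t = ((e * N - U) / (2 * N + 1)) / N"
      using N by (simp add: field_simps)
    moreover have "\<bar>(e * N - U) / (2 * N + 1)\<bar> \<le> 2"
    proof -
      have "\<bar>e * N\<bar> \<le> 1 * N"
        unfolding abs_mult using e N by (intro mult_mono) auto
      then have "\<bar>e * N - U\<bar> \<le> 2 * (2 * N + 1)"
        using N U abs_triangle_ineq4[of "e * N" U] by simp
      then show ?thesis
        using N by (simp add: pos_divide_le_eq)
    qed
    ultimately show ?thesis
      using N by (simp only: abs_divide[of _ N] abs_of_pos N_def[symmetric] divide_right_mono)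
  next
    case False
    define e :: real where
      "e = of_bool (i = 0) + of_bool (card (children t v) + 1 = i) - of_bool (card (children t v) = i)"
    have e: "-1 \<le> e" "e \<le> 1"
      by (auto simp: e_def)
    have "proportion i (next_tree t v) = (U + e) / (N + 1)"
      using False
      by (simp add: next_tree_def proportion_def num_nodes_add_child[OF t v] card_add_child[OF t]
          U_def N_def e_def algebra_simps)
    then have "proportion i (next_tree t v) - proportion i t = (U + e) / (N + 1) - U / N"
      by (simp add: proportion_def[of i t] U_def N_def)
    then have "proportion i (next_tree t v) - proportion i t = ((e * N - U) / (N + 1)) / N"
      using N by (simp add: field_simps)
    moreover have "\<bar>(e * N - U) / (N + 1)\<bar> \<le> 2"
    proof -
      have "\<bar>e * N\<bar> \<le> 1 * N"
        unfolding abs_mult using e N by (intro mult_mono) auto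
      then have "\<bar>e * N - U\<bar> \<le> 2 * (N + 1)"
        using N U abs_triangle_ineq4[of "e * N" U] by simp
      then show ?thesis
        using N by (simp add: pos_divide_le_eq)
    qed
    ultimately show ?thesis
      using N by (simp only: abs_divide[of _ N] abs_of_pos N_def[symmetric] divide_right_mono)
  qed
qed

section \<open>Drift of the energy\<close>

definition excess :: "nat \<Rightarrow> word set \<Rightarrow> real" where
  "excess i t = real (num_nodes_with_children i t) - real (card t) / 2 ^ (i + 1)"

text \<open>The first power of \<open>card t\<close> in the denominator is the one for which the
  gain from the rare doublings balances the loss from the growing denominator. The sum over j \<le>
  i lets the contribution fed in from class j - 1 cancel against the dissipation of that
  class.\<close>

definition energy :: "nat \<Rightarrow> word set \<Rightarrow> real" where
  "energy i t = (\<Sum>j\<le>i. (excess j t)\<^sup>2 / real (card t))"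

lemma energy_nonneg: "0 \<le> energy i t"
  unfolding energy_def by (intro sum_nonneg) auto

lemma abs_excess_le:
  assumes "finite t"
  shows "\<bar>excess i t\<bar> \<le> real (card t)"
proof -
  have "real (card t) / 2 ^ (i + 1) \<le> real (card t) / 1"
    by (intro divide_left_mono one_le_power) auto
  moreover have "0 \<le> real (card t) / 2 ^ (i + 1)"
    by simp
  ultimately show ?thesis
    using num_nodes_le_card[OF assms, of i] unfolding excess_def by linarith
qed

lemma inverse_power2_le_1: "1 / (2::real) ^ (i + 1) \<le> 1"
  unfolding power_one_over[symmetric] by (rule power_le_one) auto

lemma excess_doubling:
  assumes "is_tree t"
  shows "\<bar>excess i (doubling t) - 2 * excess i t\<bar> \<le> 1"
proof -
  define h where "h = 1 / (2::real) ^ (i + 1)"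
  have "excess i (doubling t) - 2 * excess i t = of_bool (i = 2) - 1 / 2 ^ (i + 1)"
    unfolding excess_def card_doubling[OF assms] num_nodes_doubling[OF assms]
    by (simp add: field_simps)
  moreover have "0 \<le> 1 / (2::real) ^ (i + 1)"
    by simp
  moreover note inverse_power2_le_1[of i]
  ultimately show ?thesis
    unfolding h_def[symmetric] by (cases "i = 2") simp_all
qed

lemma excess_add_child:
  assumes "is_tree t" "v \<in> t"
  shows "excess i (add_child t v) - excess i t =
    of_bool (i = 0) + of_bool (card (children t v) + 1 = i) - of_bool (card (children t v) = i)
      - 1 / 2 ^ (i + 1)"
  unfolding excess_def num_nodes_add_child[OF assms] card_add_child[OF assms(1)]
  by (simp add: add_divide_distrib)

lemma abs_excess_add_child:
  assumes "is_tree t" "v \<in> t"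
  shows "\<bar>excess i (add_child t v) - excess i t\<bar> \<le> 2"
proof -
  define h where "h = 1 / (2::real) ^ (i + 1)"
  have "0 \<le> h" "h \<le> 1"
    using inverse_power2_le_1[of i] by (simp_all add: h_def)
  then show ?thesis
    unfolding excess_add_child[OF assms] h_def[symmetric] by (cases "i = 0") (simp_all add: of_bool_def)
qed

text \<open>Class i gains from class i - 1 and loses to class i + 1; the multiples of
  \<open>card t\<close> cancel because 2 / 2 ^ (i + 1) = 1 / 2 ^ i. This fixes the limit values. The
  sum includes the root, where the actual step is a doubling; \<open>energy_term_step\<close> takes
  that term out again.\<close>

lemma sum_excess_add_child:
  assumes t: "is_tree t"
  shows "(\<Sum>v\<in>t. excess i (add_child t v) - excess i t)
    = (case i of 0 \<Rightarrow> 0 | Suc j \<Rightarrow> excess j t) - excess i t"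
proof -
  have "(\<Sum>v\<in>t. excess i (add_child t v) - excess i t)
      = (\<Sum>v\<in>t. of_bool (i = 0) + of_bool (card (children t v) + 1 = i)
          - of_bool (card (children t v) = i) - 1 / 2 ^ (i + 1))"
    by (intro sum.cong excess_add_child[OF t]) auto
  also have "\<dots> = real (card t) * of_bool (i = 0) + (\<Sum>v\<in>t. of_bool (card (children t v) + 1 = i))
      - real (num_nodes_with_children i t) - real (card t) / 2 ^ (i + 1)"
    using is_treeD(1)[OF t]
    by (simp add: sum.distrib sum_subtractf real_num_nodes)
  finally show ?thesis
    using is_treeD(1)[OF t]
    by (cases i) (simp_all add: excess_def real_num_nodes)
qed

lemma energy_term_step:
  fixes i :: nat
  assumes t: "is_tree t"
  defines "N \<equiv> real (card t)"
  defines "P \<equiv> (case i of 0 \<Rightarrow> 0 | Suc j \<Rightarrow> excess j t)"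
  shows "(\<Sum>v\<in>t. (excess i (next_tree t v))\<^sup>2 / real (card (next_tree t v)))
    \<le> (excess i t)\<^sup>2 + (P\<^sup>2 - (excess i t)\<^sup>2) / (N + 1) + 11"
proof -
  define D where "D = excess i t"
  define d where "d v = excess i (add_child t v) - D" for v
  define e where "e = excess i (doubling t) - 2 * D"
  have N: "N > 0" and fin: "finite t"
    using is_treeD(1,5)[OF t] by (simp_all add: N_def)
  have D: "\<bar>D\<bar> \<le> N"
    using abs_excess_le[OF fin] by (simp add: D_def N_def)
  then have D2: "D\<^sup>2 \<le> N\<^sup>2"
    using N by (metis abs_le_square_iff abs_of_pos)
  have d: "\<bar>d v\<bar> \<le> 2" if "v \<in> t" for v
    using abs_excess_add_child[OF t that] by (simp add: d_def D_def)
  have sumd: "(\<Sum>v\<in>t. d v) = P - D"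
    using sum_excess_add_child[OF t, of i] by (simp add: d_def D_def P_def)
  have e: "\<bar>e\<bar> \<le> 1"
    using excess_doubling[OF t, of i] by (simp add: e_def D_def)
  have d2: "(\<Sum>v\<in>t. (d v)\<^sup>2) \<le> 4 * N"
  proof -
    have "(\<Sum>v\<in>t. (d v)\<^sup>2) \<le> (\<Sum>v\<in>t. 4)"
      using d abs_le_square_iff[of _ "2::real"] by (intro sum_mono) fastforce
    then show ?thesis by (simp add: N_def)
  qed
  \<comment> \<open>The root is included at first so that \<open>sumd\<close> applies. Removing its
    term costs up to 4 N, which together with \<open>d2\<close> makes the 8 N below.\<close>
  have "(\<Sum>v\<in>t. (D + d v)\<^sup>2) = N * D\<^sup>2 + 2 * D * (\<Sum>v\<in>t. d v) + (\<Sum>v\<in>t. (d v)\<^sup>2)"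
    by (simp add: power2_sum sum.distrib sum_distrib_left N_def)
  moreover have "(D + d [])\<^sup>2 \<ge> D\<^sup>2 - 4 * N"
  proof -
    have "\<bar>D * d []\<bar> \<le> N * 2"
      unfolding abs_mult using D d[OF is_treeD(2)[OF t]] N by (intro mult_mono) auto
    then have "D * d [] \<ge> - 2 * N" by linarith
    then show ?thesis
      using zero_le_power2[of "d []"] unfolding power2_sum by linarith
  qed
  moreover have "2 * D * (P - D) \<le> P\<^sup>2 - D\<^sup>2"
    using zero_le_power2[of "P - D"] by (simp add: power2_eq_square algebra_simps)
  ultimately have "(\<Sum>v\<in>t - {[]}. (D + d v)\<^sup>2) \<le> (N - 2) * D\<^sup>2 + P\<^sup>2 + 8 * N"
    using d2 is_treeD(2)[OF t] fin by (simp add: sum_diff1 sumd algebra_simps)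
  moreover have "(\<Sum>v\<in>t - {[]}. (excess i (next_tree t v))\<^sup>2 / real (card (next_tree t v)))
      = (\<Sum>v\<in>t - {[]}. (D + d v)\<^sup>2) / (N + 1)"
    unfolding sum_divide_distrib
    by (intro sum.cong) (auto simp: next_tree_def card_add_child[OF t] d_def N_def algebra_simps)
  ultimately have A: "(\<Sum>v\<in>t - {[]}. (excess i (next_tree t v))\<^sup>2 / real (card (next_tree t v)))
      \<le> ((N - 2) * D\<^sup>2 + P\<^sup>2 + 8 * N) / (N + 1)"
    using N by (simp add: divide_right_mono)
  have "(2 * D + e)\<^sup>2 \<le> 4 * D\<^sup>2 + 4 * N + 1"
  proof -
    have "\<bar>D * e\<bar> \<le> N * 1"
      unfolding abs_mult using D e N by (intro mult_mono) auto
    moreover have "e\<^sup>2 \<le> 1"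
      using e by (simp add: abs_square_le_1)
    ultimately show ?thesis
      unfolding power2_sum by (simp add: power_mult_distrib)
  qed
  moreover have "excess i (next_tree t []) = 2 * D + e" "real (card (next_tree t [])) = 2 * N + 1"
    by (simp_all add: next_tree_def e_def card_doubling[OF t] N_def)
  ultimately have B: "(excess i (next_tree t []))\<^sup>2 / real (card (next_tree t []))
      \<le> (4 * D\<^sup>2 + 4 * N + 1) / (2 * N + 1)"
    using N by (simp add: divide_right_mono)
  \<comment> \<open>Bringing the doubling term to the denominator N + 1 costs at most 1, because |D|
    \<le> N.\<close>
  have "4 * D\<^sup>2 / (2 * N + 1) - 2 * D\<^sup>2 / (N + 1) = 2 * D\<^sup>2 / ((2 * N + 1) * (N + 1))"
    using N by (simp add: field_simps)
  also have "\<dots> \<le> 1"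
  proof -
    have "(2 * N + 1) * (N + 1) = 2 * N\<^sup>2 + 3 * N + 1"
      by (simp add: algebra_simps power2_eq_square)
    then show ?thesis
      using N D2 by (subst divide_le_eq_1_pos) (auto intro: add_nonneg_pos)
  qed
  finally have C: "4 * D\<^sup>2 / (2 * N + 1) \<le> 2 * D\<^sup>2 / (N + 1) + 1"
    by simp
  have "(4 * D\<^sup>2 + 4 * N + 1) / (2 * N + 1) = 4 * D\<^sup>2 / (2 * N + 1) + (4 * N + 1) / (2 * N + 1)"
    by (simp add: add_divide_distrib)
  moreover have "(4 * N + 1) / (2 * N + 1) \<le> 2"
    using N by (simp add: divide_simps)
  ultimately have B': "(4 * D\<^sup>2 + 4 * N + 1) / (2 * N + 1) \<le> 2 * D\<^sup>2 / (N + 1) + 3"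
    using C by linarith
  have "((N - 2) * D\<^sup>2 + P\<^sup>2 + 8 * N) / (N + 1) + 2 * D\<^sup>2 / (N + 1)
      = D\<^sup>2 + (P\<^sup>2 - D\<^sup>2) / (N + 1) + 8 * N / (N + 1)"
    using N by (simp add: divide_simps) (simp add: algebra_simps)
  moreover have "8 * N / (N + 1) \<le> 8"
    using N by (simp add: divide_simps)
  ultimately have E: "((N - 2) * D\<^sup>2 + P\<^sup>2 + 8 * N) / (N + 1) + 2 * D\<^sup>2 / (N + 1)
      \<le> D\<^sup>2 + (P\<^sup>2 - D\<^sup>2) / (N + 1) + 8"
    by linarith
  have "(\<Sum>v\<in>t. (excess i (next_tree t v))\<^sup>2 / real (card (next_tree t v)))
      = (excess i (next_tree t []))\<^sup>2 / real (card (next_tree t []))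
        + (\<Sum>v\<in>t - {[]}. (excess i (next_tree t v))\<^sup>2 / real (card (next_tree t v)))"
    using fin is_treeD(2)[OF t] by (rule sum.remove)
  then show ?thesis
    using A B B' E unfolding D_def[symmetric] by linarith
qed

text \<open>The left side is the conditional mean of the next energy under a uniform pick. Summed
  over j \<le> i, the drift terms telescope to a nonpositive remainder.\<close>

lemma energy_step:
  assumes t: "is_tree t"
  shows "(\<Sum>v\<in>t. energy i (next_tree t v)) / real (card t)
    \<le> energy i t + 11 * (real i + 1) / real (card t)"
proof -
  define N where "N = real (card t)"
  define P where "P j = (case j of 0 \<Rightarrow> 0 | Suc j \<Rightarrow> excess j t)" for j
  have N: "N > 0"
    using is_treeD(5)[OF t] by (simp add: N_def)
  have tele: "(\<Sum>j\<le>i. (P j)\<^sup>2 - (excess j t)\<^sup>2) = - (excess i t)\<^sup>2"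
    by (induction i) (auto simp: P_def)
  have "(\<Sum>v\<in>t. energy i (next_tree t v))
      = (\<Sum>j\<le>i. \<Sum>v\<in>t. (excess j (next_tree t v))\<^sup>2 / real (card (next_tree t v)))"
    unfolding energy_def by (rule sum.swap)
  also have "\<dots> \<le> (\<Sum>j\<le>i. (excess j t)\<^sup>2 + ((P j)\<^sup>2 - (excess j t)\<^sup>2) / (N + 1) + 11)"
    unfolding P_def N_def by (intro sum_mono energy_term_step[OF t])
  also have "\<dots> = N * energy i t + (- (excess i t)\<^sup>2) / (N + 1) + 11 * (real i + 1)"
    using N unfolding sum.distrib sum_divide_distrib[symmetric] tele
    by (simp add: energy_def sum_divide_distrib[symmetric] flip: N_def)
  also have "\<dots> \<le> N * energy i t + 11 * (real i + 1)"
    using N by simp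
  finally show ?thesis
    using N by (simp add: divide_simps mult.commute flip: N_def)
qed

lemma proportion_error_le:
  assumes t: "is_tree t"
  shows "(proportion i t - 1 / 2 ^ (i + 1))\<^sup>2 \<le> energy i t / real (card t)"
proof -
  have N: "real (card t) > 0"
    using is_treeD(5)[OF t] by simp
  have "proportion i t - 1 / 2 ^ (i + 1) = excess i t / real (card t)"
    using N by (simp add: proportion_def excess_def diff_divide_distrib)
  then have "(proportion i t - 1 / 2 ^ (i + 1))\<^sup>2 = (excess i t)\<^sup>2 / real (card t) / real (card t)"
    by (simp add: power_divide power2_eq_square)
  also have "(excess i t)\<^sup>2 / real (card t) \<le> energy i t"
    unfolding energy_def by (rule member_le_sum[of i]) auto
  finally show ?thesis
    using N by (simp add: divide_right_mono)
qed

lemma energy_root: "energy i {[]} \<le> real i + 1"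
proof -
  have "(excess j {[]})\<^sup>2 \<le> 1" for j
    using abs_excess_le[of "{[]}" j] by (simp add: abs_square_le_1)
  then have "energy i {[]} \<le> (\<Sum>j\<le>i. 1)"
    unfolding energy_def by (intro sum_mono) simp
  then show ?thesis by simp
qed

section \<open>The law of the picked nodes\<close>

text \<open>Rebuilds the tree from the picks, the latest pick at the head, so that list recursion
  follows time.\<close>

primrec tree_of :: "word list \<Rightarrow> word set" where
  "tree_of [] = {[]}"
| "tree_of (v # h) = next_tree (tree_of h) v"

text \<open>An explicit discrete model of the picks, in which conditioning on the past becomes an
  iterated integral.\<close>

primrec history_pmf :: "nat \<Rightarrow> word list pmf" where
  "history_pmf 0 = return_pmf []"
| "history_pmf (Suc n) =
    bind_pmf (history_pmf n) (\<lambda>h. map_pmf (\<lambda>v. v # h) (pmf_of_set (tree_of h)))"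

text \<open>Ensures that \<open>pmf_of_set (tree_of h)\<close> is a genuine uniform law for every
  history that occurs. The bound on \<open>card\<close> turns the drift error into O(1/n).\<close>

lemma history_pmf_support:
  assumes "h \<in> set_pmf (history_pmf n)"
  shows "length h = n" "is_tree (tree_of h)" "n + 1 \<le> card (tree_of h)"
proof -
  have "length h = n \<and> is_tree (tree_of h) \<and> n + 1 \<le> card (tree_of h)"
    using assms
  proof (induction n arbitrary: h)
    case 0
    then show ?case by (simp add: is_tree_root)
  next
    case (Suc n)
    from Suc.prems obtain h' v where h': "h' \<in> set_pmf (history_pmf n)" and h: "h = v # h'"
      and v: "v \<in> set_pmf (pmf_of_set (tree_of h'))"
      by auto
    note IH = Suc.IH[OF h']
    have "v \<in> tree_of h'"
      using v IH is_treeD(1,4)[of "tree_of h'"] by simp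
    then show ?case
      using IH card_next_tree[of "tree_of h'" v] is_tree_next_tree[of "tree_of h'" v]
      by (simp add: h)
  qed
  then show "length h = n" "is_tree (tree_of h)" "n + 1 \<le> card (tree_of h)"
    by auto
qed

text \<open>Iterating \<open>energy_step\<close> adds at most 11 (i + 1) / (n + 1) at time n. These
  increments are dominated by those of a multiple of the square root, a bound that closes under
  induction.\<close>

lemma nn_integral_energy_history:
  "(\<integral>\<^sup>+h. ennreal (energy i (tree_of h)) \<partial>history_pmf n)
    \<le> ennreal (44 * (real i + 1) * sqrt (real n + 1))"
proof (induction n)
  case 0
  have "energy i {[]} \<le> 44 * (real i + 1)"
    using energy_root[of i] by simp
  then show ?case by (simp add: ennreal_leI del: distrib_left_numeral)
next
  case (Suc n)
  define c where "c = real i + 1"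
  have c: "c > 0" by (simp add: c_def)
  have "(\<integral>\<^sup>+h. ennreal (energy i (tree_of h)) \<partial>history_pmf (Suc n))
      = (\<integral>\<^sup>+h. (\<integral>\<^sup>+v. ennreal (energy i (next_tree (tree_of h) v)) \<partial>pmf_of_set (tree_of h))
          \<partial>history_pmf n)"
    by simp
  also have "\<dots> \<le> (\<integral>\<^sup>+h. ennreal (energy i (tree_of h)) + ennreal (11 * c / real (n + 1)) \<partial>history_pmf n)"
  proof (intro nn_integral_mono_AE, unfold AE_measure_pmf_iff, intro ballI)
    fix h assume "h \<in> set_pmf (history_pmf n)"
    note h = history_pmf_support[OF this]
    have "(\<integral>\<^sup>+v. ennreal (energy i (next_tree (tree_of h) v)) \<partial>pmf_of_set (tree_of h))
        = ennreal ((\<Sum>v\<in>tree_of h. energy i (next_tree (tree_of h) v)) / real (card (tree_of h)))"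
      using is_treeD(1,4,5)[OF h(2)]
      by (simp add: nn_integral_pmf_of_set energy_nonneg sum_nonneg divide_ennreal
          ennreal_of_nat_eq_real_of_nat)
    also have "\<dots> \<le> ennreal (energy i (tree_of h) + 11 * c / real (card (tree_of h)))"
      using energy_step[OF h(2), of i] by (intro ennreal_leI) (simp add: c_def)
    also have "\<dots> \<le> ennreal (energy i (tree_of h) + 11 * c / real (n + 1))"
      using h(3) c by (intro ennreal_leI add_left_mono divide_left_mono) auto
    also have "\<dots> = ennreal (energy i (tree_of h)) + ennreal (11 * c / real (n + 1))"
      using c energy_nonneg by (intro ennreal_plus) auto
    finally show "(\<integral>\<^sup>+v. ennreal (energy i (next_tree (tree_of h) v)) \<partial>pmf_of_set (tree_of h))
        \<le> ennreal (energy i (tree_of h)) + ennreal (11 * c / real (n + 1))" .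
  qed
  also have "\<dots> = (\<integral>\<^sup>+h. ennreal (energy i (tree_of h)) \<partial>history_pmf n) + ennreal (11 * c / real (n + 1))"
    by (simp add: nn_integral_add)
  also have "\<dots> \<le> ennreal (44 * c * sqrt (real n + 1)) + ennreal (11 * c / real (n + 1))"
    using Suc.IH unfolding c_def by (rule add_right_mono)
  also have "\<dots> = ennreal (44 * c * sqrt (real n + 1) + 11 * c / real (n + 1))"
    using c by (subst ennreal_plus) auto
  also have "\<dots> \<le> ennreal (44 * c * sqrt (real n + 2))"
  proof (rule ennreal_leI)
    define x y where "x = sqrt (real n + 1)" and "y = sqrt (real n + 2)"
    have xy: "0 < x" "x < y" "y\<^sup>2 - x\<^sup>2 = 1" "x\<^sup>2 = real (n + 1)"
      by (auto simp: x_def y_def)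
    have "(y - x) * (y + x) = 1"
      using xy(3) by (simp add: power2_eq_square algebra_simps)
    moreover have "y + x \<le> 4 * x\<^sup>2"
    proof -
      have "y\<^sup>2 \<le> (2 * x\<^sup>2)\<^sup>2"
        by (simp add: xy(4)) (simp add: y_def power2_eq_square algebra_simps)
      then have "y \<le> 2 * x\<^sup>2"
        by (rule power2_le_imp_le) simp
      then show ?thesis using xy by simp
    qed
    ultimately have "1 \<le> (y - x) * (4 * x\<^sup>2)"
      using xy mult_left_mono[of "y + x" "4 * x\<^sup>2" "y - x"] by simp
    then have "11 * c / x\<^sup>2 \<le> 44 * c * (y - x)"
      using c xy mult_left_mono[of 1 "(y - x) * (4 * x\<^sup>2)" "11 * c"]
      by (simp add: divide_simps algebra_simps)
    then show "44 * c * sqrt (real n + 1) + 11 * c / real (n + 1) \<le> 44 * c * sqrt (real n + 2)"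
      unfolding xy(4)[symmetric] x_def[symmetric] y_def[symmetric] by (simp add: algebra_simps)
  qed
  finally show ?case
    by (simp add: c_def add.commute)
qed

section \<open>Identification of the process with the discrete model\<close>

context recursive_tree_doubling
begin

primrec history :: "nat \<Rightarrow> 'a \<Rightarrow> word list" where
  "history 0 \<omega> = []"
| "history (Suc n) \<omega> = \<nu> n \<omega> # history n \<omega>"

lemma tree_of_history: "\<omega> \<in> space M \<Longrightarrow> tree_of (history n \<omega>) = \<tau> n \<omega>"
  by (induction n) (auto simp: tree_0 tree_Suc)

lemma length_history [simp]: "length (history n \<omega>) = n"
  by (induction n) auto

lemma measurable_history [measurable]: "history n \<in> measurable M (count_space UNIV)"
proof (induction n)
  case 0
  then show ?case by simp
next
  case (Suc n)
  note [measurable] = Suc measurable_pick[of n]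
  have "(\<lambda>\<omega>. (\<lambda>(v, h). v # h) (\<nu> n \<omega>, history n \<omega>)) \<in> measurable M (count_space UNIV)"
    by (rule measurable_compose_countable) simp_all
  then show ?case by simp
qed

text \<open>
  The conditioning events of the locale are exactly the values of the history; the latest pick comes
  first, hence \<open>drop\<close> and \<open>rev\<close>.
\<close>

lemma history_eq_iff:
  assumes "\<omega> \<in> space M"
  shows "history (length h) \<omega> = h \<longleftrightarrow>
    (\<forall>k\<le>length h. \<tau> k \<omega> = tree_of (drop (length h - k) h)) \<and>
    (\<forall>k<length h. \<nu> k \<omega> = rev h ! k)"
proof -
  have "history (length h) \<omega> = h \<longleftrightarrow> (\<forall>k<length h. \<nu> k \<omega> = rev h ! k)" for h
    by (induction h) (auto simp: nth_append less_Suc_eq)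
  moreover have "\<tau> k \<omega> = tree_of (drop (length h - k) h)"
    if "history (length h) \<omega> = h" "k \<le> length h" for k
  proof -
    have "history k \<omega> = drop (length h - k) h"
      using that by (induction h arbitrary: k) (auto simp: le_Suc_eq Suc_diff_le)
    then show ?thesis
      using tree_of_history[OF assms, of k] by simp
  qed
  ultimately show ?thesis by blast
qed

text \<open>Chain rule: the event that the first n picks form a given list is a conditioning event
  of \<open>uniform_pick\<close>, so each further pick multiplies the probability by the uniform
  weight.\<close>

lemma prob_history: "\<P>(\<omega> in M. history n \<omega> = h) = pmf (history_pmf n) h"
proof (induction n arbitrary: h)
  case 0
  then show ?case by (cases "h = []") (auto simp: prob_space)
next
  case (Suc n)
  show ?case
  proof (cases "length h = Suc n")
    case False
    then have "{\<omega> \<in> space M. history (Suc n) \<omega> = h} = {}"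
      using length_history[of "Suc n"] by blast
    then have "\<P>(\<omega> in M. history (Suc n) \<omega> = h) = 0"
      by (simp only: measure_empty)
    moreover have "h \<notin> set_pmf (history_pmf (Suc n))"
      using False history_pmf_support(1) by blast
    ultimately show ?thesis
      by (simp add: set_pmf_iff del: history.simps history_pmf.simps)
  next
    case True
    then obtain v l where h: "h = v # l" and l: "length l = n"
      by (cases h) auto
    define K where "K g = pmf_of_set (tree_of g)" for g
    \<comment> \<open>Only the past g = l can lead to \<open>v # l\<close>, so the mixture over g
      collapses to one product.\<close>
    have "pmf (map_pmf (\<lambda>v. v # g) (K g)) (v # l) = pmf (K l) v * indicator {l} g" for g
    proof (cases "g = l")
      case True
      then show ?thesis
        using pmf_map_inj'[of "\<lambda>v. v # l" "K l" v] by (simp add: inj_def)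
    next
      case False
      then show ?thesis
        by (auto simp: pmf_eq_0_set_pmf)
    qed
    then have rhs: "pmf (history_pmf (Suc n)) h = pmf (K l) v * pmf (history_pmf n) l"
      by (simp add: h pmf_bind measure_pmf_single flip: K_def)
    define Q where "Q \<omega> \<longleftrightarrow> (\<forall>k\<le>n. \<tau> k \<omega> = tree_of (drop (n - k) l)) \<and> (\<forall>k<n. \<nu> k \<omega> = rev l ! k)" for \<omega>
    have Q: "Q \<omega> \<longleftrightarrow> history n \<omega> = l" if "\<omega> \<in> space M" for \<omega>
      using history_eq_iff[OF that, of l] l by (simp add: Q_def)
    have setQ: "{\<omega> \<in> space M. Q \<omega>} = {\<omega> \<in> space M. history n \<omega> = l}"
      by (simp add: Q cong: conj_cong)
    have PQ: "\<P>(\<omega> in M. Q \<omega>) = pmf (history_pmf n) l"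
      unfolding setQ by (rule Suc.IH)
    have lhs: "\<P>(\<omega> in M. history (Suc n) \<omega> = h) = \<P>(\<omega> in M. \<nu> n \<omega> = v \<and> Q \<omega>)"
      by (intro arg_cong[of _ _ prob]) (auto simp: h Q)
    show ?thesis
    proof (cases "\<P>(\<omega> in M. Q \<omega>) > 0")
      case True
      have "\<P>(\<omega> in M. \<nu> n \<omega> = v \<bar> Q \<omega>) = pmf (K l) v"
        unfolding Q_def K_def
        using uniform_pick[of n "\<lambda>k. tree_of (drop (n - k) l)" "\<lambda>k. rev l ! k" v] True
        unfolding Q_def by simp
      then show ?thesis
        using True unfolding lhs rhs cond_prob_def PQ by (simp add: divide_simps mult.commute)
    next
      case False
      \<comment> \<open>On a null past \<open>uniform_pick\<close> says nothing, but both sides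
        vanish.\<close>
      then have 0: "\<P>(\<omega> in M. Q \<omega>) = 0"
        by (simp add: zero_less_measure_iff)
      have "{\<omega> \<in> space M. Q \<omega>} \<in> events"
        unfolding setQ by measurable
      then have "\<P>(\<omega> in M. \<nu> n \<omega> = v \<and> Q \<omega>) \<le> \<P>(\<omega> in M. Q \<omega>)"
        by (intro finite_measure_mono) auto
      then have "\<P>(\<omega> in M. \<nu> n \<omega> = v \<and> Q \<omega>) = 0"
        using 0 by (simp add: measure_le_0_iff)
      then show ?thesis
        using 0 unfolding lhs rhs PQ by simp
    qed
  qed
qed

lemma distr_history: "distr M (count_space UNIV) (history n) = measure_pmf (history_pmf n)"
proof (rule measure_eqI_countable[of _ UNIV])
  fix h :: "word list"
  have "history n -` {h} \<inter> space M = {\<omega> \<in> space M. history n \<omega> = h}"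
    by auto
  then show "emeasure (distr M (count_space UNIV) (history n)) {h} = emeasure (history_pmf n) {h}"
    using prob_history[of n h] by (simp add: emeasure_distr emeasure_eq_measure emeasure_pmf_single)
qed auto

text \<open>The picks are constrained only in law, so a pick may leave the tree on a null set.
  Almost surely every history lies in the support of its law, where the tree properties
  hold.\<close>

lemma AE_tree: "AE \<omega> in M. \<forall>n. is_tree (\<tau> n \<omega>) \<and> n + 1 \<le> card (\<tau> n \<omega>) \<and> \<nu> n \<omega> \<in> \<tau> n \<omega>"
proof -
  have *: "AE \<omega> in M. history n \<omega> \<in> set_pmf (history_pmf n)" for n
  proof -
    have "AE h in distr M (count_space UNIV) (history n). h \<in> set_pmf (history_pmf n)"
      unfolding distr_history by (simp add: AE_measure_pmf_iff)
    then show ?thesis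
      by (subst (asm) AE_distr_iff) auto
  qed
  have "AE \<omega> in M. \<forall>n. history n \<omega> \<in> set_pmf (history_pmf n)"
    using * by (simp add: AE_all_countable)
  then show ?thesis
  proof (rule AE_mp, intro AE_I2 impI allI)
    fix \<omega> n assume \<omega>: "\<omega> \<in> space M" and "\<forall>n. history n \<omega> \<in> set_pmf (history_pmf n)"
    then have h: "history n \<omega> \<in> set_pmf (history_pmf n)"
      and h': "history (Suc n) \<omega> \<in> set_pmf (history_pmf (Suc n))"
      by blast+
    note S = history_pmf_support[OF h]
    \<comment> \<open>The pick at time n is the head of the history at time n + 1, so the support
      one step later is the one that locates it.\<close>
    have "\<nu> n \<omega> \<in> set_pmf (pmf_of_set (tree_of (history n \<omega>)))"
      using h' by auto
    then have "\<nu> n \<omega> \<in> tree_of (history n \<omega>)"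
      using is_treeD(1,4)[OF S(2)] by simp
    then show "is_tree (\<tau> n \<omega>) \<and> n + 1 \<le> card (\<tau> n \<omega>) \<and> \<nu> n \<omega> \<in> \<tau> n \<omega>"
      using S tree_of_history[OF \<omega>, of n] by simp
  qed
qed

section \<open>Mean square error and the subsequence of fourth powers\<close>

lemma nn_integral_tree:
  "(\<integral>\<^sup>+\<omega>. f (\<tau> n \<omega>) \<partial>M) = (\<integral>\<^sup>+h. f (tree_of h) \<partial>history_pmf n)"
proof -
  have "(\<integral>\<^sup>+\<omega>. f (\<tau> n \<omega>) \<partial>M) = (\<integral>\<^sup>+\<omega>. f (tree_of (history n \<omega>)) \<partial>M)"
    by (intro nn_integral_cong) (simp add: tree_of_history)
  also have "\<dots> = (\<integral>\<^sup>+h. f (tree_of h) \<partial>distr M (count_space UNIV) (history n))"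
    by (subst nn_integral_distr) auto
  finally show ?thesis
    by (simp add: distr_history)
qed

text \<open>Any \<open>f\<close> qualifies, because on \<open>space M\<close> the tree factors
  through the discrete variable \<open>history n\<close>.\<close>

lemma measurable_tree: "(\<lambda>\<omega>. f (\<tau> n \<omega>)) \<in> borel_measurable M"
proof -
  have "(\<lambda>\<omega>. f (tree_of (history n \<omega>))) \<in> borel_measurable M"
    by (rule measurable_compose[OF measurable_history]) simp
  then show ?thesis
    by (rule measurable_cong[THEN iffD1, rotated]) (simp add: tree_of_history)
qed

lemma proportion_error_integral:
  "(\<integral>\<^sup>+\<omega>. ennreal ((proportion i (\<tau> n \<omega>) - 1 / 2 ^ (i + 1))\<^sup>2) \<partial>M)
    \<le> ennreal (44 * (real i + 1) / sqrt (real n + 1))"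
proof -
  have "(\<integral>\<^sup>+\<omega>. ennreal ((proportion i (\<tau> n \<omega>) - 1 / 2 ^ (i + 1))\<^sup>2) \<partial>M)
      = (\<integral>\<^sup>+h. ennreal ((proportion i (tree_of h) - 1 / 2 ^ (i + 1))\<^sup>2) \<partial>history_pmf n)"
    by (rule nn_integral_tree)
  also have "\<dots> \<le> (\<integral>\<^sup>+h. ennreal (1 / (real n + 1)) * ennreal (energy i (tree_of h)) \<partial>history_pmf n)"
  proof (intro nn_integral_mono_AE, unfold AE_measure_pmf_iff, intro ballI)
    fix h assume "h \<in> set_pmf (history_pmf n)"
    note h = history_pmf_support[OF this]
    have "(proportion i (tree_of h) - 1 / 2 ^ (i + 1))\<^sup>2 \<le> energy i (tree_of h) / real (card (tree_of h))"
      by (rule proportion_error_le[OF h(2)])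
    also have "\<dots> \<le> energy i (tree_of h) / (real n + 1)"
      using h(3) energy_nonneg[of i "tree_of h"] by (intro divide_left_mono) auto
    finally show "ennreal ((proportion i (tree_of h) - 1 / 2 ^ (i + 1))\<^sup>2)
        \<le> ennreal (1 / (real n + 1)) * ennreal (energy i (tree_of h))"
      by (subst ennreal_mult[symmetric]) (auto simp: energy_nonneg intro!: ennreal_leI)
  qed
  also have "\<dots> = ennreal (1 / (real n + 1)) * (\<integral>\<^sup>+h. ennreal (energy i (tree_of h)) \<partial>history_pmf n)"
    by (rule nn_integral_cmult) simp
  also have "\<dots> \<le> ennreal (1 / (real n + 1)) * ennreal (44 * (real i + 1) * sqrt (real n + 1))"
    by (intro mult_left_mono nn_integral_energy_history) simp
  also have "\<dots> = ennreal (44 * (real i + 1) / sqrt (real n + 1))"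
    by (subst ennreal_mult[symmetric]) (auto intro!: arg_cong[of _ _ ennreal] simp: power2_eq_square[symmetric] divide_simps)
  finally show ?thesis .
qed

lemma proportion_subsequence:
  "AE \<omega> in M. (\<lambda>k. proportion i (\<tau> ((k + 1) ^ 4) \<omega>)) \<longlonglongrightarrow> 1 / 2 ^ (i + 1)"
proof -
  define c where "c = 44 * (real i + 1)"
  define Y where "Y k \<omega> = (proportion i (\<tau> ((k + 1) ^ 4) \<omega>) - 1 / 2 ^ (i + 1))\<^sup>2" for k \<omega>
  have [measurable]: "Y k \<in> borel_measurable M" for k
    unfolding Y_def by (rule measurable_tree)
  have sums: "summable (\<lambda>k. c / (real k + 1)\<^sup>2)"
  proof -
    have "summable (\<lambda>k. inverse (real k ^ 2))"
      by (rule inverse_power_summable) simp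
    then have "summable (\<lambda>k. inverse (real (Suc k) ^ 2))"
      by (subst summable_Suc_iff)
    from summable_mult[OF this, of c] show ?thesis
      by (simp only: divide_inverse of_nat_Suc add.commute)
  qed
  have "(\<integral>\<^sup>+\<omega>. (\<Sum>k. ennreal (Y k \<omega>)) \<partial>M) = (\<Sum>k. \<integral>\<^sup>+\<omega>. ennreal (Y k \<omega>) \<partial>M)"
    by (rule nn_integral_suminf) measurable
  also have "\<dots> \<le> (\<Sum>k. ennreal (c / (real k + 1)\<^sup>2))"
  proof (intro suminf_le allI)
    fix k
    have "(\<integral>\<^sup>+\<omega>. ennreal (Y k \<omega>) \<partial>M) \<le> ennreal (c / sqrt (real ((k + 1) ^ 4) + 1))"
      unfolding Y_def c_def by (rule proportion_error_integral)
    also have "\<dots> \<le> ennreal (c / (real k + 1)\<^sup>2)"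
    proof (intro ennreal_leI divide_left_mono)
      show "(real k + 1)\<^sup>2 \<le> sqrt (real ((k + 1) ^ 4) + 1)"
        by (intro real_le_rsqrt) (simp add: add.commute flip: power_mult)
    qed (auto simp: c_def add_pos_nonneg)
    finally show "(\<integral>\<^sup>+\<omega>. ennreal (Y k \<omega>) \<partial>M) \<le> ennreal (c / (real k + 1)\<^sup>2)" .
  qed auto
  also have "\<dots> = ennreal (\<Sum>k. c / (real k + 1)\<^sup>2)"
    using sums by (intro suminf_ennreal2) (auto simp: c_def)
  also have "\<dots> < \<infinity>"
    by simp
  finally have "AE \<omega> in M. (\<Sum>k. ennreal (Y k \<omega>)) \<noteq> \<infinity>"
    by (intro nn_integral_PInf_AE) (auto simp: less_top)
  then show ?thesis
  proof eventually_elim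
    case (elim \<omega>)
    then have "summable (\<lambda>k. Y k \<omega>)"
      by (intro summable_suminf_not_top) (auto simp: Y_def)
    then have "(\<lambda>k. Y k \<omega>) \<longlonglongrightarrow> 0"
      by (rule summable_LIMSEQ_zero)
    from tendsto_real_sqrt[OF this]
    have "(\<lambda>k. proportion i (\<tau> ((k + 1) ^ 4) \<omega>) - 1 / 2 ^ (i + 1)) \<longlonglongrightarrow> 0"
      unfolding Y_def real_sqrt_abs real_sqrt_zero by (rule tendsto_rabs_zero_cancel)
    then show ?case
      by (rule LIM_zero_cancel)
  qed
qed

end

section \<open>Almost sure convergence\<close>

text \<open>Between consecutive fourth powers the sequence moves by at most C ((k + 2) ^ 4 - (k + 1)
  ^ 4) / ((k + 1) ^ 4 + 1), which is O(1/k).\<close>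

lemma tendsto_of_slow_variation:
  fixes x :: "nat \<Rightarrow> real"
  assumes step: "\<And>n. \<bar>x (Suc n) - x n\<bar> \<le> C / (real n + 1)"
    and sub: "(\<lambda>k. x ((k + 1) ^ 4)) \<longlonglongrightarrow> L"
  shows "x \<longlonglongrightarrow> L"
proof (rule LIMSEQ_I)
  fix r :: real assume r: "r > 0"
  have C: "C \<ge> 0"
    using order_trans[OF abs_ge_zero step[of 0]] by simp
  have var: "\<bar>x (m + d) - x m\<bar> \<le> C * real d / (real m + 1)" for m d
  proof (induction d)
    case (Suc d)
    have "C / (real (m + d) + 1) \<le> C / (real m + 1)"
      using C by (intro divide_left_mono) auto
    then have "\<bar>x (m + Suc d) - x m\<bar> \<le> C * real d / (real m + 1) + C / (real m + 1)"
      using Suc step[of "m + d"] by (simp only: add_Suc_right)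
    then show ?case
      by (simp add: add_divide_distrib distrib_left add.commute)
  qed simp
  have "(\<lambda>k. C * ((real k + 2) ^ 4 - (real k + 1) ^ 4) / ((real k + 1) ^ 4 + 1)) \<longlonglongrightarrow> 0"
    by real_asymp
  then have "\<forall>\<^sub>F k in sequentially. C * ((real k + 2) ^ 4 - (real k + 1) ^ 4) / ((real k + 1) ^ 4 + 1) < r / 2"
    using r by (auto dest: order_tendstoD(2)[where a = "r / 2"])
  moreover have "\<forall>\<^sub>F k in sequentially. dist (x ((k + 1) ^ 4)) L < r / 2"
    using sub r by (intro tendstoD) auto
  ultimately have "\<forall>\<^sub>F k in sequentially.
      C * ((real k + 2) ^ 4 - (real k + 1) ^ 4) / ((real k + 1) ^ 4 + 1) < r / 2 \<and>
      dist (x ((k + 1) ^ 4)) L < r / 2"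
    by eventually_elim simp
  then obtain K where K: "\<And>k. k \<ge> K \<Longrightarrow>
      C * ((real k + 2) ^ 4 - (real k + 1) ^ 4) / ((real k + 1) ^ 4 + 1) < r / 2 \<and>
      dist (x ((k + 1) ^ 4)) L < r / 2"
    by (auto simp: eventually_sequentially)
  have "norm (x n - L) < r" if n: "n \<ge> (K + 1) ^ 4" for n
  proof -
    \<comment> \<open>Induction on n locates it between fourth powers: k is kept until n + 1 reaches
      (k + 2) ^ 4 and is then increased by one.\<close>
    have "\<exists>k\<ge>K. (k + 1) ^ 4 \<le> n \<and> n < (k + 2) ^ 4"
      using n
    proof (induction n rule: dec_induct)
      case base
      have "(K + 1) ^ 4 < (K + 2) ^ 4"
        by (intro power_strict_mono) auto
      then show ?case by blast
    next
      case (step n)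
      then obtain k where k: "k \<ge> K" "(k + 1) ^ 4 \<le> n" "n < (k + 2) ^ 4"
        by blast
      show ?case
      proof (cases "Suc n < (k + 2) ^ 4")
        case True
        then show ?thesis using k by (intro exI[of _ k]) auto
      next
        case False
        then have "Suc n = (k + 2) ^ 4" using k by simp
        moreover have "(k + 2) ^ 4 < (k + 1 + 2) ^ 4" "k + 2 = k + 1 + 1"
          by (intro power_strict_mono) auto
        ultimately show ?thesis
          using k(1) by (metis le_add1 order.trans order_refl)
      qed
    qed
    then obtain k where k: "k \<ge> K" "(k + 1) ^ 4 \<le> n" "n < (k + 2) ^ 4"
      by blast
    define m where "m = (k + 1) ^ 4"
    have rn: "real n \<le> (real k + 2) ^ 4"
      using of_nat_mono[OF less_imp_le[OF k(3)], where 'a = real] by (simp add: add.commute)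
    have rm: "real m = (real k + 1) ^ 4"
      by (simp add: m_def add.commute)
    have "\<bar>x n - x m\<bar> \<le> C * real (n - m) / (real m + 1)"
      using var[of m "n - m"] k(2) by (simp add: m_def)
    also have "\<dots> \<le> C * ((real k + 2) ^ 4 - (real k + 1) ^ 4) / ((real k + 1) ^ 4 + 1)"
      unfolding rm[symmetric] using rn C k(2)
      by (intro divide_right_mono mult_left_mono) (auto simp: m_def)
    also have "\<dots> < r / 2"
      using K[OF k(1)] by blast
    finally have "\<bar>x n - x m\<bar> < r / 2" .
    moreover have "\<bar>x m - L\<bar> < r / 2"
      using K[OF k(1)] by (simp add: m_def dist_real_def)
    ultimately show ?thesis unfolding real_norm_def by linarith
  qed
  then show "\<exists>no. \<forall>n\<ge>no. norm (x n - L) < r"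
    by blast
qed

theorem theorem1p3:
  fixes M :: "'a measure" and \<nu> :: "nat \<Rightarrow> 'a \<Rightarrow> word" and \<tau> :: "nat \<Rightarrow> 'a \<Rightarrow> word set"
    and i :: nat
  assumes "recursive_tree_doubling M \<nu> \<tau>"
  shows "AE \<omega> in M. (\<lambda>n. real (num_nodes_with_children i (\<tau> n \<omega>)) / real (card (\<tau> n \<omega>)))
           \<longlonglongrightarrow> 1 / 2 ^ (i + 1)"
proof -
  interpret recursive_tree_doubling M \<nu> \<tau>
    by (rule assms)
  \<comment> \<open>The recursion \<open>tree_Suc\<close> is available on \<open>space M\<close>, so
    membership is carried along with the almost sure properties.\<close>
  have "AE \<omega> in M. \<omega> \<in> space M"
    by simp
  with AE_tree proportion_subsequence[of i]
  have "AE \<omega> in M. (\<lambda>n. proportion i (\<tau> n \<omega>)) \<longlonglongrightarrow> 1 / 2 ^ (i + 1)"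
  proof eventually_elim
    case (elim \<omega>)
    show ?case
    proof (rule tendsto_of_slow_variation[OF _ elim(2)])
      fix n
      have t: "is_tree (\<tau> n \<omega>)" "n + 1 \<le> card (\<tau> n \<omega>)" "\<nu> n \<omega> \<in> \<tau> n \<omega>"
        using elim(1) by blast+
      have "\<bar>proportion i (\<tau> (Suc n) \<omega>) - proportion i (\<tau> n \<omega>)\<bar> \<le> 2 / real (card (\<tau> n \<omega>))"
        unfolding tree_Suc[OF elim(3)] by (rule proportion_next_tree[OF t(1,3)])
      also have "\<dots> \<le> 2 / (real n + 1)"
        using t(2) by (intro divide_left_mono) auto
      finally show "\<bar>proportion i (\<tau> (Suc n) \<omega>) - proportion i (\<tau> n \<omega>)\<bar> \<le> 2 / (real n + 1)" .
    qed
  qed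
  then show ?thesis
    unfolding proportion_def .
qed

end
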